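(* Let $\{a_n\}_{n\geqslant 1}$ be a sequence of positive real numbers and let $N\geqslant 1$ be an integer. Suppose that there are sequences of positive real numbers $h_n$ $(n\geqslant N)$, $g_n$ $(n\geqslant N)$ and $f_n$ $(n\geqslant N-1)$ such that $a_n\leqslant h_n$ and $\frac{a_{n+1}}{a_n}\leqslant g_n$ for all $n\geqslant N$, $f_n\leqslant \frac{a_{n+1}}{a_n}$ for all $n\geqslant \max(1,N-1)$, and for all $n\geqslant N$ \[ 6\log h_n+(n^2-n)(2n+5)\log g_n-(n^2+n)(n+2)\log f_{n-1}-(n^3-n)\log f_{n+1}\leqslant 0 . \] Then the root sequence $\{\sqrt[n]{a_n}\}_{n\geqslant N}$ is ratio log-convex.
   Context: A sequence $\{c_n\}_{n\geqslant N}$ is log-convex if $c_n^2\leqslant c_{n+1}c_{n-1}$ for all $n\geqslant N+1$. A sequence $\{c_n\}_{n\geqslant N}$ of positive real numbers is ratio log-convex if the sequence $\{c_{n+1}/c_n\}_{n\geqslant N}$ is log-convex. *)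

theory Defs
  imports Complex_Main
begin

text \<open>
  A sequence \<open>{c_n}\<close> with \<open>n \<ge> N\<close> is represented by a total function on \<open>nat\<close> together with
  its starting index \<open>N\<close>; values below \<open>N\<close> are irrelevant.
\<close>

definition log_convex_from :: "nat \<Rightarrow> (nat \<Rightarrow> real) \<Rightarrow> bool" where
  "log_convex_from N c \<longleftrightarrow> (\<forall>n \<ge> N + 1. (c n)\<^sup>2 \<le> c (n + 1) * c (n - 1))"

definition ratio_log_convex_from :: "nat \<Rightarrow> (nat \<Rightarrow> real) \<Rightarrow> bool" where
  "ratio_log_convex_from N c \<longleftrightarrow>
     (\<forall>n \<ge> N. c n > 0) \<and> log_convex_from N (\<lambda>n. c (n + 1) / c n)"

end

theory Submission
  imports Defs
begin

text \<open>
  Put \<open>L\<^sub>n = ln a\<^sub>n\<close>. After taking logarithms, ratio log-convexity of \<open>a\<^sub>n\<^bsup>1/n\<^esup>\<close> says that the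
  third difference of \<open>L\<^sub>n / n\<close> over the points \<open>n - 1, n, n + 1, n + 2\<close> is nonnegative.
  Clearing the denominators and expressing the other three values through \<open>L\<^sub>n\<close> and the steps
  \<open>L\<^sub>k\<^sub>+\<^sub>1 - L\<^sub>k = ln (a\<^sub>k\<^sub>+\<^sub>1 / a\<^sub>k)\<close> turns this into an upper bound \<open>0\<close> on a
  linear expression in \<open>L\<^sub>n\<close> and these steps, with exactly the coefficients of the hypothesis
  (\<open>third_difference_of_quotients\<close>). The coefficients of \<open>L\<^sub>n\<close> and of the middle step are
  positive and those of the two outer steps are negative, so replacing \<open>a\<^sub>n\<close> and the middle ratio
  by upper bounds and the outer ratios by lower bounds can only increase the expression, and the
  hypothesis says that the result is still at most \<open>0\<close>.
\<close>

text \<open>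
  The coefficient \<open>6\<close> of \<open>x1\<close> comes from the third difference of \<open>1 / n\<close>, which is
  \<open>- 6 / ((n - 1) n (n + 1) (n + 2))\<close>; the left-hand side carries the opposite sign.
\<close>
lemma third_difference_of_quotients:
  fixes n x0 x1 x2 x3 :: real
  assumes "n > 1"
  shows "(n - 1) * n * (n + 1) * (n + 2)
      * (3 * (x2 / (n + 1)) - 3 * (x1 / n) - x3 / (n + 2) + x0 / (n - 1))
    = 6 * x1 + (n\<^sup>2 - n) * (2 * n + 5) * (x2 - x1)
      - (n\<^sup>2 + n) * (n + 2) * (x1 - x0) - (n ^ 3 - n) * (x3 - x2)"
proof -
  (* In terms of the quotients themselves both sides are polynomials. *)
  define y0 y1 y2 y3 where "y0 = x0 / (n - 1)" and "y1 = x1 / n"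
    and "y2 = x2 / (n + 1)" and "y3 = x3 / (n + 2)"
  have x: "x0 = (n - 1) * y0" "x1 = n * y1" "x2 = (n + 1) * y2" "x3 = (n + 2) * y3"
    using assms by (simp_all add: y0_def y1_def y2_def y3_def)
  show ?thesis
    unfolding y0_def[symmetric] y1_def[symmetric] y2_def[symmetric] y3_def[symmetric]
    unfolding x by (simp add: algebra_simps power2_eq_square power3_eq_cube)
qed

lemma ratio_log_convex_from_iff_ln:
  assumes pos: "\<And>n. n \<ge> N \<Longrightarrow> c n > 0"
  shows "ratio_log_convex_from N c \<longleftrightarrow>
    (\<forall>n \<ge> N + 1. 3 * ln (c (n + 1)) - 3 * ln (c n) - ln (c (n + 2)) + ln (c (n - 1)) \<le> 0)"
proof -
  have "(c (n + 1) / c n)\<^sup>2 \<le> (c (n + 2) / c (n + 1)) * (c n / c (n - 1)) \<longleftrightarrow>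
      3 * ln (c (n + 1)) - 3 * ln (c n) - ln (c (n + 2)) + ln (c (n - 1)) \<le> 0"
    if "n \<ge> N + 1" for n
  proof -
    have p: "c (n - 1) > 0" "c n > 0" "c (n + 1) > 0" "c (n + 2) > 0"
      using that by (auto intro!: pos)
    have "(c (n + 1) / c n)\<^sup>2 \<le> (c (n + 2) / c (n + 1)) * (c n / c (n - 1)) \<longleftrightarrow>
        ln ((c (n + 1) / c n)\<^sup>2) \<le> ln ((c (n + 2) / c (n + 1)) * (c n / c (n - 1)))"
      using p by (intro ln_le_cancel_iff[symmetric]) simp_all
    also have "ln ((c (n + 1) / c n)\<^sup>2) = 2 * (ln (c (n + 1)) - ln (c n))"
      using p by (simp add: ln_realpow ln_div)
    also have "ln ((c (n + 2) / c (n + 1)) * (c n / c (n - 1)))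
        = ln (c (n + 2)) - ln (c (n + 1)) + (ln (c n) - ln (c (n - 1)))"
      using p by (simp add: ln_mult ln_div)
    finally show ?thesis by (simp add: algebra_simps)
  qed
  then show ?thesis
    using pos by (auto simp: ratio_log_convex_from_def log_convex_from_def)
qed

theorem theorem3p4:
  fixes a h g f :: "nat \<Rightarrow> real" and N :: nat
  assumes N_pos: "N \<ge> 1"
    and a_pos: "\<And>n. n \<ge> 1 \<Longrightarrow> a n > 0"
    and h_pos: "\<And>n. n \<ge> N \<Longrightarrow> h n > 0"
    and g_pos: "\<And>n. n \<ge> N \<Longrightarrow> g n > 0"
    and f_pos: "\<And>n. n \<ge> N - 1 \<Longrightarrow> f n > 0"
    and a_le_h: "\<And>n. n \<ge> N \<Longrightarrow> a n \<le> h n"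
    and ratio_le_g: "\<And>n. n \<ge> N \<Longrightarrow> a (n + 1) / a n \<le> g n"
    and f_le_ratio: "\<And>n. n \<ge> max 1 (N - 1) \<Longrightarrow> f n \<le> a (n + 1) / a n"
    and ineq: "\<And>n. n \<ge> N \<Longrightarrow>
      6 * ln (h n) + ((real n)\<^sup>2 - real n) * (2 * real n + 5) * ln (g n)
      - ((real n)\<^sup>2 + real n) * (real n + 2) * ln (f (n - 1))
      - ((real n) ^ 3 - real n) * ln (f (n + 1)) \<le> 0"
  shows "ratio_log_convex_from N (\<lambda>n. root n (a n))"
proof -
  have root_pos: "root n (a n) > 0" if "n \<ge> N" for n
    using that N_pos a_pos[of n] by simp
  have "3 * ln (root (n + 1) (a (n + 1))) - 3 * ln (root n (a n))
      - ln (root (n + 2) (a (n + 2))) + ln (root (n - 1) (a (n - 1))) \<le> 0"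
    (is "?D \<le> 0") if n: "n \<ge> N + 1" for n
  proof -
    let ?n = "real n"
    have n2: "n \<ge> 2" and n1: "?n > 1" using n N_pos by simp_all
    have a: "a (n - 1) > 0" "a n > 0" "a (n + 1) > 0" "a (n + 2) > 0"
      using n2 by (auto intro!: a_pos)
    have le_h: "ln (a n) \<le> ln (h n)"
      using a_le_h[of n] a n by simp
    have step_le_g: "ln (a (n + 1)) - ln (a n) \<le> ln (g n)"
    proof -
      have "ln (a (n + 1) / a n) \<le> ln (g n)"
        using ratio_le_g[of n] n a by (intro ln_mono) auto
      then show ?thesis using a by (simp add: ln_div)
    qed
    have f_le_step: "ln (f k) \<le> ln (a (k + 1)) - ln (a k)" if "k \<ge> N" for k
    proof -
      have k: "a k > 0" "a (k + 1) > 0" "f k > 0"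
        using that N_pos by (auto intro!: a_pos f_pos)
      have "ln (f k) \<le> ln (a (k + 1) / a k)"
        using f_le_ratio[of k] that N_pos k by (intro ln_mono) auto
      then show ?thesis using k by (simp add: ln_div)
    qed
    have f_le_left: "ln (f (n - 1)) \<le> ln (a n) - ln (a (n - 1))"
      using f_le_step[of "n - 1"] n by simp
    have f_le_right: "ln (f (n + 1)) \<le> ln (a (n + 2)) - ln (a (n + 1))"
      using f_le_step[of "n + 1"] n by simp
    have "(?n\<^sup>2 - ?n) * (2 * ?n + 5) \<ge> 0" "(?n\<^sup>2 + ?n) * (?n + 2) \<ge> 0" "?n ^ 3 - ?n \<ge> 0"
      using n1 self_le_power[of ?n 2] self_le_power[of ?n 3] by simp_all
    then have "(?n\<^sup>2 - ?n) * (2 * ?n + 5) * (ln (a (n + 1)) - ln (a n))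
          \<le> (?n\<^sup>2 - ?n) * (2 * ?n + 5) * ln (g n)"
        "(?n\<^sup>2 + ?n) * (?n + 2) * ln (f (n - 1))
          \<le> (?n\<^sup>2 + ?n) * (?n + 2) * (ln (a n) - ln (a (n - 1)))"
        "(?n ^ 3 - ?n) * ln (f (n + 1))
          \<le> (?n ^ 3 - ?n) * (ln (a (n + 2)) - ln (a (n + 1)))"
      using step_le_g f_le_left f_le_right by (simp_all only: mult_left_mono)
    then have "6 * ln (a n)
        + (?n\<^sup>2 - ?n) * (2 * ?n + 5) * (ln (a (n + 1)) - ln (a n))
        - (?n\<^sup>2 + ?n) * (?n + 2) * (ln (a n) - ln (a (n - 1)))
        - (?n ^ 3 - ?n) * (ln (a (n + 2)) - ln (a (n + 1))) \<le> 0"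
      using ineq[of n] n le_h by linarith
    moreover have "?D = 3 * (ln (a (n + 1)) / (?n + 1)) - 3 * (ln (a n) / ?n)
        - ln (a (n + 2)) / (?n + 2) + ln (a (n - 1)) / (?n - 1)"
      using a n2 by (simp add: ln_root of_nat_diff add.commute)
    ultimately have "(?n - 1) * ?n * (?n + 1) * (?n + 2) * ?D \<le> 0"
      using third_difference_of_quotients[OF n1, of "ln (a (n + 1))" "ln (a n)"
          "ln (a (n + 2))" "ln (a (n - 1))"]
      by simp
    moreover have "(?n - 1) * ?n * (?n + 1) * (?n + 2) > 0"
      using n1 by simp
    ultimately show "?D \<le> 0"
      by (meson mult_pos_pos not_less)
  qed
  then show ?thesis
    using root_pos by (subst ratio_log_convex_from_iff_ln) auto
qed

end
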